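(* Let $q=p^a$ with $p$ prime, and let $C$ and $D$ be smooth projective (absolutely irreducible) curves over $\mathbb{F}_q$. Assume there exists an integer $k>1$ such that $L_D(t)=Q(t^k)L_C(t)$ for some polynomial $Q(t)\in\mathbb{Z}[t]$. Then $\#C(\mathbb{F}_{q^m})=\#D(\mathbb{F}_{q^m})$ for every positive integer $m$ that is not divisible by $k$.
   Context: For a smooth projective absolutely irreducible curve $C$ over $\mathbb{F}_q$, the L-polynomial $L_C(t)\in\mathbb{Z}[t]$ is defined by $\exp\left(\sum_{n\ge1}\#C(\mathbb{F}_{q^n})\frac{t^n}{n}\right)=\frac{L_C(t)}{(1-t)(1-qt)}$. *)

theory Defs
  imports
    "HOL-Computational_Algebra.Computational_Algebra"
    "HOL-Library.Poly_Mapping"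
    "HOL-Library.Cardinality"
    "HOL-Algebra.Algebraic_Closure_Type"
    "Jordan_Normal_Form.DL_Rank"
begin

section \<open>Multivariate polynomials\<close>

text \<open>
  A polynomial in the variables \<open>X\<^sub>0, X\<^sub>1, \<dots>\<close> is a finitely supported map from exponent vectors
  to coefficients.
\<close>

type_synonym 'k mvpoly = "(nat \<Rightarrow>\<^sub>0 nat) \<Rightarrow>\<^sub>0 'k"

definition eval_mv :: "'k::comm_ring_1 mvpoly \<Rightarrow> (nat \<Rightarrow> 'k) \<Rightarrow> 'k" where
  "eval_mv f x = (\<Sum>m\<in>Poly_Mapping.keys f. Poly_Mapping.lookup f m * (\<Prod>i\<in>Poly_Mapping.keys m. x i ^ Poly_Mapping.lookup m i))"

text \<open>
  The subtraction of exponents truncates when \<open>X\<^sub>i\<close> does not occur in the monomial, but then the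
  coefficient is zero.
\<close>

definition partial_mv :: "nat \<Rightarrow> 'k::comm_ring_1 mvpoly \<Rightarrow> 'k mvpoly" where
  "partial_mv i f =
     (\<Sum>m\<in>Poly_Mapping.keys f. Poly_Mapping.single (m - Poly_Mapping.single i 1)
                                      (of_nat (Poly_Mapping.lookup m i) * Poly_Mapping.lookup f m))"

definition forms :: "nat \<Rightarrow> 'k::comm_ring_1 mvpoly set" where
  "forms n = {f. \<exists>d. \<forall>m\<in>Poly_Mapping.keys f. Poly_Mapping.keys m \<subseteq> {..n} \<and> (\<Sum>i\<in>Poly_Mapping.keys m. Poly_Mapping.lookup m i) = d}"

abbreviation base_change :: "'a::field mvpoly \<Rightarrow> 'a alg_closure mvpoly" where
  "base_change \<equiv> Poly_Mapping.map to_ac"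

section \<open>Projective space and its Zariski topology\<close>

text \<open>
  Vectors in \<open>k\<^sup>n\<^sup>+\<^sup>1\<close> are functions vanishing beyond \<open>n\<close>. A point of projective space is the set of
  all its homogeneous coordinate vectors.
\<close>

definition nonzero_vecs :: "nat \<Rightarrow> (nat \<Rightarrow> 'k::field) set" where
  "nonzero_vecs n = {x. (\<forall>i>n. x i = 0) \<and> (\<exists>i. x i \<noteq> 0)}"

definition proj_point :: "(nat \<Rightarrow> 'k::field) \<Rightarrow> (nat \<Rightarrow> 'k) set" where
  "proj_point x = {\<lambda>i. c * x i | c. c \<noteq> 0}"

definition proj_space :: "nat \<Rightarrow> (nat \<Rightarrow> 'k::field) set set" where
  "proj_space n = proj_point ` nonzero_vecs n"

definition zero_locus :: "nat \<Rightarrow> 'k::field mvpoly set \<Rightarrow> (nat \<Rightarrow> 'k) set set" where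
  "zero_locus n F = {P \<in> proj_space n. \<forall>x\<in>P. \<forall>f\<in>F. eval_mv f x = 0}"

definition zariski_closed :: "nat \<Rightarrow> (nat \<Rightarrow> 'k::field) set set \<Rightarrow> bool" where
  "zariski_closed n Z \<longleftrightarrow> (\<exists>F\<subseteq>forms n. Z = zero_locus n F)"

definition irreducible_closed :: "nat \<Rightarrow> (nat \<Rightarrow> 'k::field) set set \<Rightarrow> bool" where
  "irreducible_closed n Z \<longleftrightarrow>
     zariski_closed n Z \<and> Z \<noteq> {} \<and>
     (\<forall>A B. zariski_closed n A \<and> zariski_closed n B \<and> Z \<subseteq> A \<union> B \<longrightarrow> Z \<subseteq> A \<or> Z \<subseteq> B)"

definition irreducible_chain ::
    "nat \<Rightarrow> (nat \<Rightarrow> 'k::field) set set \<Rightarrow> (nat \<Rightarrow> 'k) set set list \<Rightarrow> bool" where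
  "irreducible_chain n V Zs \<longleftrightarrow>
     sorted_wrt (\<subset>) Zs \<and> (\<forall>Z\<in>set Zs. irreducible_closed n Z \<and> Z \<subseteq> V)"

text \<open>Krull dimension: \<open>Z\<^sub>0 \<subset> \<dots> \<subset> Z\<^sub>d\<close> is a chain of maximal length.\<close>

definition has_dim :: "nat \<Rightarrow> (nat \<Rightarrow> 'k::field) set set \<Rightarrow> nat \<Rightarrow> bool" where
  "has_dim n V d \<longleftrightarrow>
     (\<exists>Zs. irreducible_chain n V Zs \<and> length Zs = d + 1) \<and>
     (\<forall>Zs. irreducible_chain n V Zs \<longrightarrow> length Zs \<le> d + 1)"

section \<open>Projective schemes and smooth curves\<close>

text \<open>
  A closed subscheme of projective space over the field \<open>'a\<close>, presented by finitely many
  defining forms.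
\<close>

record (overloaded) ('a::zero) proj_scheme =
  ambient_dim :: nat
  equations :: "'a mvpoly list"

definition geometric_points ::
    "'a::field proj_scheme \<Rightarrow> (nat \<Rightarrow> 'a alg_closure) set set" where
  "geometric_points C = zero_locus (ambient_dim C) (base_change ` set (equations C))"

definition jacobian ::
    "'a::field proj_scheme \<Rightarrow> (nat \<Rightarrow> 'a alg_closure) \<Rightarrow> 'a alg_closure mat" where
  "jacobian C x =
     mat (length (equations C)) (ambient_dim C + 1)
       (\<lambda>(r, i). eval_mv (partial_mv i (base_change (equations C ! r))) x)"

text \<open>
  Smoothness is the Jacobian criterion at every geometric point: the rank is the codimension
  \<open>n - 1\<close>. By Euler's relation, homogeneous coordinates and affine charts give the same rank.
  Irreducibility is tested over the algebraic closure, so it is absolute irreducibility. The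
  criterion refers to the given equations, so it also makes the scheme reduced.
\<close>

definition smooth_projective_curve :: "'a::field proj_scheme \<Rightarrow> bool" where
  "smooth_projective_curve C \<longleftrightarrow>
     set (equations C) \<subseteq> forms (ambient_dim C) \<and>
     irreducible_closed (ambient_dim C) (geometric_points C) \<and>
     has_dim (ambient_dim C) (geometric_points C) 1 \<and>
     (\<forall>P\<in>geometric_points C. \<forall>x\<in>P.
        vec_space.rank (length (equations C)) (jacobian C x) + 1 = ambient_dim C)"

section \<open>Points over extensions of a finite field and the L-polynomial\<close>

text \<open>
  For \<open>q = CARD('a)\<close>, the field with \<open>q\<^sup>m\<close> elements is the set of \<open>y\<close> in the algebraic closure with
  \<open>y\<^bsup>q\<^sup>m\<^esup> = y\<close>. A point is rational over it iff it has homogeneous coordinates in it.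
\<close>

definition rational_points ::
    "'a::{field,finite} proj_scheme \<Rightarrow> nat \<Rightarrow> (nat \<Rightarrow> 'a alg_closure) set set" where
  "rational_points C m =
     {P \<in> geometric_points C. \<exists>x\<in>P. \<forall>i. x i ^ (CARD('a) ^ m) = x i}"

definition log_zeta :: "'a::{field,finite} proj_scheme \<Rightarrow> rat fps" where
  "log_zeta C =
     Abs_fps (\<lambda>n. if n = 0 then 0 else of_nat (card (rational_points C n)) / of_nat n)"

definition is_L_polynomial :: "'a::{field,finite} proj_scheme \<Rightarrow> int poly \<Rightarrow> bool" where
  "is_L_polynomial C L \<longleftrightarrow>
     fps_compose (fps_exp 1) (log_zeta C) =
       fps_of_poly (map_poly of_int L) /
         ((1 - fps_X) * (1 - fps_const (of_nat CARD('a)) * fps_X))"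

text \<open>
  The cardinalities used above are those of finite sets, and the L-polynomial is unique.
\<close>

lemma card_field_ge_2: "CARD('a::{field,finite}) \<ge> 2"
proof -
  have "card {0, 1 :: 'a} \<le> CARD('a)"
    by (rule card_mono) auto
  then show ?thesis by simp
qed

lemma finite_rational_points:
  fixes C :: "'a::{field,finite} proj_scheme"
  assumes "m > 0"
  shows "finite (rational_points C m)"
proof -
  define N where "N = CARD('a) ^ m"
  define n where "n = ambient_dim C"
  define A :: "'a alg_closure set" where "A = {y. y ^ N = y}"
  have "1 < CARD('a)" using card_field_ge_2[where 'a='a] by simp
  then have N: "N > 1" unfolding N_def using assms by (metis one_less_power)
  define p :: "'a alg_closure poly"
    where "p = Polynomial.monom 1 N - Polynomial.monom 1 1"
  have "poly.coeff p N = 1" using N by (simp add: p_def)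
  then have "p \<noteq> 0" by auto
  then have "finite {y. poly p y = 0}" by (rule poly_roots_finite)
  then have finA: "finite A" by (simp add: A_def p_def poly_monom)
  have "finite {x. \<forall>i. (i \<in> {..n} \<longrightarrow> x i \<in> A) \<and> (i \<notin> {..n} \<longrightarrow> x i = 0)}" (is "finite ?V")
    by (rule finite_set_of_finite_funs) (use finA in auto)
  moreover have "rational_points C m \<subseteq> proj_point ` ?V"
  proof
    fix P assume "P \<in> rational_points C m"
    then obtain x where P: "P \<in> proj_space n" and x: "x \<in> P" "\<And>i. x i \<in> A"
      unfolding rational_points_def geometric_points_def zero_locus_def A_def N_def n_def by auto
    from P obtain y where y: "y \<in> nonzero_vecs n" "P = proj_point y"
      unfolding proj_space_def by auto
    with x(1) obtain c where c: "c \<noteq> 0" "x = (\<lambda>i. c * y i)"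
      unfolding proj_point_def by auto
    have "P = proj_point x"
      unfolding y(2) c(2) proj_point_def
    proof (intro subset_antisym subsetI)
      fix z assume "z \<in> {\<lambda>i. d * y i | d. d \<noteq> 0}"
      then obtain d where d: "d \<noteq> 0" "z = (\<lambda>i. d * y i)" by blast
      then have "z = (\<lambda>i. (d / c) * (c * y i))" "d / c \<noteq> 0" using c(1) by simp_all
      then show "z \<in> {\<lambda>i. d * (c * y i) | d. d \<noteq> 0}" by blast
    next
      fix z assume "z \<in> {\<lambda>i. d * (c * y i) | d. d \<noteq> 0}"
      then obtain d where d: "d \<noteq> 0" "z = (\<lambda>i. d * (c * y i))" by blast
      then have "z = (\<lambda>i. (d * c) * y i)" "d * c \<noteq> 0" using c(1) by (simp_all add: mult.assoc)
      then show "z \<in> {\<lambda>i. d * y i | d. d \<noteq> 0}" by blast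
    qed
    moreover have "x \<in> ?V" using x(2) y(1) c by (auto simp: nonzero_vecs_def)
    ultimately show "P \<in> proj_point ` ?V" by blast
  qed
  ultimately show ?thesis using finite_subset by blast
qed

lemma is_L_polynomial_unique:
  assumes "is_L_polynomial C L" "is_L_polynomial C L'"
  shows "L = L'"
proof -
  define d :: "rat fps" where "d = (1 - fps_X) * (1 - fps_const (of_nat CARD('a)) * fps_X)"
  have "fps_nth d 0 = 1" by (simp add: d_def)
  then have d: "d \<noteq> 0" "is_unit d" by auto
  have "fps_of_poly (map_poly rat_of_int L) / d = fps_of_poly (map_poly of_int L') / d"
    using assms unfolding is_L_polynomial_def d_def by simp
  then have "fps_of_poly (map_poly rat_of_int L) = fps_of_poly (map_poly of_int L')"
    using d by (metis unit_imp_dvd dvd_div_mult_self)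
  then have "map_poly rat_of_int L = map_poly of_int L'"
    by (metis fps_of_poly_eq_iff)
  then have "rat_of_int (poly.coeff L i) = of_int (poly.coeff L' i)" for i
    by (metis coeff_map_poly of_int_0)
  then show ?thesis by (intro poly_eqI) simp
qed

end

theory Submission
  imports Defs
begin

text \<open>
  Write \<open>F\<close> and \<open>G\<close> for the logarithms of the two zeta functions and \<open>R = Q(t\<^sup>k)\<close>, so that
  \<open>exp G = R exp F\<close>. Logarithmic differentiation gives \<open>(G' - F') R = R'\<close>. As \<open>R\<close> only involves
  powers of \<open>t\<^sup>k\<close> and has constant term 1, the series \<open>t (G' - F') = t R' / R\<close> also only involves
  powers of \<open>t\<^sup>k\<close>, and its coefficients are the differences of the point counts.
\<close>

text \<open>Strong induction on \<open>n\<close>, comparing coefficients of t^n. For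
  \<open>i < n\<close> the product of \<open>h_i\<close> and \<open>R_(n-i)\<close> vanishes: if
  \<open>k\<close> divides \<open>n - i\<close>, it cannot divide \<open>i + 1\<close>, so
  \<open>h_i = 0\<close> by induction; otherwise \<open>R_(n-i) = 0\<close>. Only
  \<open>h_n * R_0\<close> survives. The divisibility condition is on \<open>Suc n\<close> because
  differentiation lowers exponents by one.\<close>

lemma fps_log_deriv_nth_eq_0:
  fixes R h :: "'a::idom fps"
  assumes eq: "h * R = fps_deriv R" and R0: "fps_nth R 0 \<noteq> 0"
    and supp: "\<And>i. \<not> k dvd i \<Longrightarrow> fps_nth R i = 0"
    and n: "\<not> k dvd Suc n"
  shows "fps_nth h n = 0"
  using n
proof (induction n rule: less_induct)
  case (less n)
  have lower: "fps_nth h i * fps_nth R (n - i) = 0" if "i < n" for i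
  proof (cases "k dvd n - i")
    case True
    have "Suc n = Suc i + (n - i)" using that by simp
    then have "\<not> k dvd Suc i" using True less.prems by (metis dvd_add)
    then show ?thesis using less.IH that by simp
  qed (simp add: supp)
  have "0 = fps_nth (fps_deriv R) n" using supp[OF less.prems] by simp
  also have "\<dots> = (\<Sum>i=0..n. fps_nth h i * fps_nth R (n - i))"
    by (simp only: eq[symmetric] fps_mult_nth)
  also have "\<dots> = (\<Sum>i\<in>{n}. fps_nth h i * fps_nth R (n - i))"
    by (rule sum.mono_neutral_right) (use lower in \<open>auto simp del: mult_eq_0_iff\<close>)
  finally show ?case using R0 by simp
qed

lemma fps_deriv_exp_compose:
  fixes F :: "'a::field_char_0 fps"
  assumes "fps_nth F 0 = 0"
  shows "fps_deriv (fps_exp 1 oo F) = (fps_exp 1 oo F) * fps_deriv F"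
  using assms by (simp add: fps_compose_deriv)

lemma fps_exp_compose_quotient_nth_eq:
  fixes F G R :: "'a::field_char_0 fps"
  assumes F0: "fps_nth F 0 = 0" and G0: "fps_nth G 0 = 0"
    and eq: "fps_exp 1 oo G = R * (fps_exp 1 oo F)"
    and supp: "\<And>i. \<not> k dvd i \<Longrightarrow> fps_nth R i = 0"
    and m: "\<not> k dvd m"
  shows "fps_nth F m = fps_nth G m"
proof -
  define E where "E = fps_exp 1 oo F"
  \<comment> \<open>Both exponentials have constant term 1.\<close>
  have R0: "fps_nth R 0 = 1"
    using arg_cong[OF eq, of "\<lambda>f. fps_nth f 0"] by simp
  have "fps_nth E 0 = 1" by (simp add: E_def)
  then have "E \<noteq> 0" by auto
  \<comment> \<open>Differentiate \<open>exp G = R * E\<close> on both sides; the common factor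
    \<open>E\<close> then cancels in the domain of power series, so no logarithm or inverse of
    \<open>R\<close> is needed.\<close>
  have "E * (R * fps_deriv G) = fps_deriv (R * E)"
    using fps_deriv_exp_compose[OF G0] by (simp add: eq E_def mult_ac)
  also have "\<dots> = E * (fps_deriv R + R * fps_deriv F)"
    using fps_deriv_exp_compose[OF F0] by (simp add: E_def algebra_simps)
  finally have "R * fps_deriv G = fps_deriv R + R * fps_deriv F"
    using \<open>E \<noteq> 0\<close> by simp
  then have h: "(fps_deriv G - fps_deriv F) * R = fps_deriv R"
    by (simp add: algebra_simps)
  obtain n where n: "m = Suc n" using m by (cases m) auto
  have "fps_nth (fps_deriv G - fps_deriv F) n = 0"
    by (rule fps_log_deriv_nth_eq_0[OF h _ supp]) (use R0 m n in auto)
  then have "of_nat (Suc n) * (fps_nth G m - fps_nth F m) = 0"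
    by (simp add: n algebra_simps)
  then show ?thesis by (simp only: mult_eq_0_iff of_nat_eq_0_iff) simp
qed

text \<open>Induction along Horner's scheme: multiplying by t^k shifts exponents by
  \<open>k\<close>, which preserves divisibility by \<open>k\<close>, and the added constant only
  affects exponent 0.\<close>

lemma coeff_pcompose_monom_eq_0:
  fixes Q :: "'a::comm_semiring_1 poly"
  assumes "\<not> k dvd i"
  shows "poly.coeff (pcompose Q (Polynomial.monom 1 k)) i = 0"
  using assms
proof (induction Q arbitrary: i)
  case (pCons c Q)
  have "poly.coeff (Polynomial.monom 1 k * pcompose Q (Polynomial.monom 1 k)) i = 0"
    using pCons by (auto simp: coeff_monom_mult dvd_minus_self)
  moreover have "poly.coeff [:c:] i = 0" using pCons.prems by (cases i) auto
  ultimately show ?case by (simp add: pcompose_pCons)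
qed simp

theorem theorem10:
  fixes C D :: "'a::{field,finite} proj_scheme"
    and L_C L_D Q :: "int poly"
    and p a q k :: nat
  assumes "prime p" and "q = p ^ a" and "CARD('a) = q"
    and "smooth_projective_curve C" and "smooth_projective_curve D"
    and "is_L_polynomial C L_C" and "is_L_polynomial D L_D"
    and "k > 1"
    and "L_D = pcompose Q (Polynomial.monom 1 k) * L_C"
  shows "\<forall>m>0. \<not> k dvd m \<longrightarrow> card (rational_points C m) = card (rational_points D m)"
proof (intro allI impI)
  fix m :: nat
  assume m: "m > 0" "\<not> k dvd m"
  define S where "S = pcompose Q (Polynomial.monom 1 k)"
  define R where "R = fps_of_poly (map_poly rat_of_int S)"
  define d :: "rat fps" where "d = (1 - fps_X) * (1 - fps_const (of_nat CARD('a)) * fps_X)"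
  \<comment> \<open>Constant term 1 makes \<open>d\<close> invertible, so \<open>R\<close> can be
    pulled out of the quotient by \<open>d\<close>.\<close>
  have "fps_nth d 0 = 1" by (simp add: d_def)
  then have "is_unit d" by simp
  have "fps_exp 1 oo log_zeta D = fps_of_poly (map_poly rat_of_int (S * L_C)) / d"
    using assms(7,9) by (simp add: is_L_polynomial_def d_def S_def)
  also have "map_poly rat_of_int (S * L_C) = map_poly rat_of_int S * map_poly rat_of_int L_C"
    by (intro poly_eqI) (simp add: coeff_map_poly coeff_mult)
  also have "fps_of_poly \<dots> / d = R * (fps_of_poly (map_poly rat_of_int L_C) / d)"
    using \<open>is_unit d\<close> by (simp add: R_def fps_of_poly_mult unit_div_mult_swap unit_div_commute mult_ac)
  also have "fps_of_poly (map_poly rat_of_int L_C) / d = fps_exp 1 oo log_zeta C"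
    using assms(6) by (simp add: is_L_polynomial_def d_def)
  finally have eq: "fps_exp 1 oo log_zeta D = R * (fps_exp 1 oo log_zeta C)" .
  have "fps_nth (log_zeta C) m = fps_nth (log_zeta D) m"
  proof (rule fps_exp_compose_quotient_nth_eq[OF _ _ eq _ m(2)])
    show "fps_nth R i = 0" if "\<not> k dvd i" for i
      using that by (simp add: R_def S_def coeff_map_poly coeff_pcompose_monom_eq_0)
  qed (simp_all add: log_zeta_def)
  then show "card (rational_points C m) = card (rational_points D m)"
    using m(1) by (simp add: log_zeta_def)
qed

end
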